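(* Let $q=e^h$ with $h>0$ and let $p\ge1$. (a) Let $n=2p+1$, let $\mathbf m=(m_{2n},\dots,m_{pn})$ be admissible, and put $l_j=m_{jn}+p-j+1$, $j=2,\dots,p$. The following representations $T(c,\mathbf m)$ of $U_q(\mathrm{so}_{2p,1})$ are unitary: (1) $c=\mathrm it+\frac12$ with $0<t<2\pi/h$, and also $c=\frac12$ for integral $\mathbf m$ (principal unitary series); (2) $\frac12<c<s+1$, where $s$ is the integer, $0\le s\le p-1$, defined by: $s=0$ if $p=1$ or $l_p>1$, and if $l_p=1$ then $s$ is the largest number $r$ for which $l_{p-r+1}=r$ (supplementary series); (3) $\mathrm{Im}\,c=\pi/h$, $\mathrm{Re}\,c>\frac12$ (strange series). (b) Let $n=2p+2$, let $\mathbf m=(m_{2n},\dots,m_{p+1,n})$ be admissible, and put $l_j=m_{jn}+p-j+1$, $j=2,\dots,p+1$. The following representations $T(c,\mathbf m)$ of $U_q(\mathrm{so}_{2p+1,1})$ are unitary: (1) $c=\mathrm it$, $0\le t<2\pi/h$ (principal unitary series); (2) $0<c<s$, where $s$ is an integer, $0\le s\le p$, such that $l_{p-r+2}=r-1$ for $r=1,2,\dots,s$ (supplementary series); (3) $\mathrm{Im}\,c=\pi/h$, $\mathrm{Re}\,c>0$ (strange series).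
   Context: Let $q=e^{h}$, $h>0$; put $q^{b}=e^{hb}$ and $[b]=\dfrac{q^{b/2}-q^{-b/2}}{q^{1/2}-q^{-1/2}}$ for $b\in\mathbb C$. Half-integers are elements of $\frac12+\mathbb Z$. $U_q(\mathrm{so}(n,\mathbb C))$ is the complex associative algebra generated by $I_{i,i-1}$, $i=2,\dots,n$, with relations $[I_{i,i-1},I_{j,j-1}]=0$ if $|i-j|>1$, and, for $2\le i\le n-1$, $$I_{i+1,i}^2I_{i,i-1}-(q^{1/2}+q^{-1/2})I_{i+1,i}I_{i,i-1}I_{i+1,i}+I_{i,i-1}I_{i+1,i}^2=-I_{i,i-1},$$ $$I_{i+1,i}I_{i,i-1}^2-(q^{1/2}+q^{-1/2})I_{i,i-1}I_{i+1,i}I_{i,i-1}+I_{i,i-1}^2I_{i+1,i}=-I_{i+1,i}.$$ $U_q(\mathrm{so}_{n-1,1})$ is this algebra with the $*$-structure (antilinear antiautomorphism) $I_{i,i-1}^*=-I_{i,i-1}$ for $i\ne n$, $I_{n,n-1}^*=I_{n,n-1}$. A representation $T$ on a dense subspace $D$ of a Hilbert space is unitary if these conditions hold for the operators on $D$: $\langle T(I_{i,i-1})x,y\rangle=-\langle x,T(I_{i,i-1})y\rangle$ for $2\le i\le n-1$ and $\langle T(I_{n,n-1})x,y\rangle=\langle x,T(I_{n,n-1})y\rangle$, for all $x,y\in D$. Admissible $\mathbf m$. $\mathbf m=(m_{2n},\dots,m_{kn})$, $k=\lfloor n/2\rfloor$, with entries all integers ("integral") or all half-integers ("half-integral"), $m_{2n}\ge\dots\ge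 m_{kn}\ge0$ if $n=2k+1$, and $m_{2n}\ge\dots\ge m_{k-1,n}\ge|m_{kn}|$ if $n=2k$. For $n=3$, $\mathbf m$ is empty and one additionally fixes whether it is called integral or half-integral. Patterns. A pattern $\alpha$ consists of the fixed entries $m_{2n},\dots,m_{kn}$ of row $n$ and rows $(m_{1k'},\dots,m_{\lfloor k'/2\rfloor,k'})$, $k'=n-1,\dots,2$, with all entries integers if $\mathbf m$ is integral and all half-integers otherwise, satisfying (for all relevant $u$) $$m_{1,2u+1}\ge m_{1,2u}\ge m_{2,2u+1}\ge\dots\ge m_{u,2u+1}\ge m_{u,2u}\ge-m_{u,2u+1},$$ $$m_{1,2u}\ge m_{1,2u-1}\ge m_{2,2u}\ge\dots\ge m_{u-1,2u-1}\ge|m_{u,2u}| ,$$ where all inequalities involving $m_{1n}$ are dropped (so $m_{1,n-1}$ is not bounded above). $\alpha^k_j$ (resp. $\bar\alpha^k_j$) is obtained from $\alpha$ by replacing $m_{jk}$ by $m_{jk}+1$ (resp. $m_{jk}-1$); terms for which the result is not a pattern are omitted. Put $l_{j,2u}=m_{j,2u}+u-j$, $l_{j,2u+1}=m_{j,2u+1}+u-j+1$ for the entries above, and $l_{1n}=c$. $D$ is the linear span of the patterns, taken as an orthonormal basis of a Hilbert space. Operators. $T(c,\mathbf m)$ acts on $D$ by $$T(I_{2u+1,2u})\alpha=\sum_{j=1}^uA^j_{2u}(\alpha)\alpha^{2u}_j-\sum_{j=1}^uA^j_{2u}(\bar\alpha^{2u}_j)\bar\alpha^{2u}_j ,$$ $$T(I_{2u+2,2u+1})\alpha=\sum_{j=1}^uB^j_{2u}(\alpha)\alpha^{2u+1}_j-\sum_{j=1}^uB^j_{2u}(\bar\alpha^{2u+1}_j)\bar\alpha^{2u+1}_j+\mathrm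 i\,\frac{\prod_{r=1}^{u+1}[l_{r,2u+2}]\prod_{r=1}^u[l_{r,2u}]}{\prod_{r=1}^u[l_{r,2u+1}][l_{r,2u+1}-1]}\,\alpha .$$ With $\lambda_r=l_{r,2u+1}$, $\lambda'_r=l_{r,2u}$, $\lambda''_r=l_{r,2u-1}$, $$A^j_{2u}(\alpha)=\left(\frac{[\lambda'_j][\lambda'_j+1]}{[2\lambda'_j][2\lambda'_j+2]}\,\frac{\prod_{r=1}^u[\lambda_r+\lambda'_j][|\lambda_r-\lambda'_j-1|]\prod_{r=1}^{u-1}[\lambda''_r+\lambda'_j][|\lambda''_r-\lambda'_j-1|]}{\prod_{r\ne j}[\lambda'_r+\lambda'_j][|\lambda'_r-\lambda'_j|][\lambda'_r+\lambda'_j+1][|\lambda'_r-\lambda'_j-1|]}\right)^{1/2},$$ and with $\lambda_r=l_{r,2u+2}$, $\lambda'_r=l_{r,2u+1}$, $\lambda''_r=l_{r,2u}$, $$B^j_{2u}(\alpha)=\left(\frac{\prod_{r=1}^{u+1}[\lambda_r+\lambda'_j][|\lambda_r-\lambda'_j|]\prod_{r=1}^{u}[\lambda''_r+\lambda'_j][|\lambda''_r-\lambda'_j|]}{\prod_{r\ne j}[\lambda'_r+\lambda'_j][|\lambda'_r-\lambda'_j|][\lambda'_r+\lambda'_j-1][|\lambda'_r-\lambda'_j-1|]}\cdot\frac1{[\lambda'_j]^2[2\lambda'_j+1][2\lambda'_j-1]}\right)^{1/2}.$$ Here $r,j\in\{1,\dots,u\}$ in the products over $r\ne j$; for $u=0$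 the second formula reads $T(I_{21})\alpha=\mathrm i[m_{12}]\alpha$. These operators satisfy the relations of $U_q(\mathrm{so}(n,\mathbb C))$. Conventions. In factors containing $l_{1n}=c$ the absolute value signs are dropped (the factors are $[c-\lambda'_j-1]$, resp. $[c-\lambda'_j]$). $[x]/[2x]$ is read as $1/(q^{x/2}+q^{-x/2})$ (also at $x=0$). The diagonal coefficient is $0$ if some $l_{r,2u+1}=1$. The square root of a displayed product is the product of square roots of its factors: positive square roots for positive factors not containing $c$, a square root fixed once for all for each $[c+x]$ ($x\in\frac12\mathbb Z$), and $([\lambda'_j]^2)^{1/2}=[\lambda'_j]$.
   Formalization: In (a)(2) the formal theorem assumes m integral; for half-integral m (s=0, 1/2<c<1) the claim fails, since raising m_{p,2p} from -1/2 to 1/2 has coefficient [c-1/2] times a positive factor, which is real and nonzero instead of imaginary. *)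

theory Defs
  imports Complex_Main "HOL-Library.Poly_Mapping"
begin

definition qpow :: "real \<Rightarrow> 'a \<Rightarrow> 'a::{real_normed_field,banach}" where
  "qpow h b = exp (of_real h * b)"

definition qnum :: "real \<Rightarrow> 'a \<Rightarrow> 'a::{real_normed_field,banach}" where
  "qnum h b = (qpow h (b / 2) - qpow h (- b / 2)) / (qpow h (1 / 2) - qpow h (- 1 / 2))"

text \<open>The value of \<open>[x] / [2 x]\<close>, including at \<open>x = 0\<close>.\<close>

definition qratio :: "real \<Rightarrow> real \<Rightarrow> real" where
  "qratio h x = 1 / (qpow h (x / 2) + qpow h (- x / 2))"

text \<open>
  The flag \<open>ii\<close> is true for integral and false for half-integral data. It is a separate parameter
  because for \<open>n = 3\<close> the tuple \<open>(m\<^sub>2\<^sub>n, \<dots>)\<close> is empty and does not determine it.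
\<close>

definition entry_ok :: "bool \<Rightarrow> real \<Rightarrow> bool" where
  "entry_ok ii x \<longleftrightarrow> (if ii then x \<in> \<int> else x - 1 / 2 \<in> \<int>)"

text \<open>\<open>m j\<close> stands for \<open>m\<^sub>j\<^sub>n\<close>, and only the indices \<open>2 \<le> j \<le> n div 2\<close> matter.\<close>

definition admissible :: "nat \<Rightarrow> bool \<Rightarrow> (nat \<Rightarrow> real) \<Rightarrow> bool" where
  "admissible n ii m \<longleftrightarrow>
     (\<forall>j\<in>{2..n div 2}. entry_ok ii (m j)) \<and>
     (\<forall>j. 2 \<le> j \<and> j + 1 \<le> n div 2 \<longrightarrow> m j \<ge> m (j + 1)) \<and>
     (if odd n then 2 \<le> n div 2 \<longrightarrow> m (n div 2) \<ge> 0
      else 3 \<le> n div 2 \<longrightarrow> m (n div 2 - 1) \<ge> \<bar>m (n div 2)\<bar>)"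

text \<open>
  A pattern is a function \<open>a\<close> with \<open>a k j\<close> standing for the \<open>j\<close>-th entry of row \<open>k\<close>. Positions that carry
  no entry, among them the first position of row \<open>n\<close>, are filled with \<open>0\<close>, so that equality of
  patterns is equality of their entries.
\<close>

type_synonym pat = "nat \<Rightarrow> nat \<Rightarrow> real"

definition positions :: "nat \<Rightarrow> (nat \<times> nat) set" where
  "positions n = {(k, j). 2 \<le> k \<and> k \<le> n \<and> 1 \<le> j \<and> j \<le> k div 2 \<and> \<not> (k = n \<and> j = 1)}"

definition interlace_odd :: "nat \<Rightarrow> pat \<Rightarrow> nat \<Rightarrow> bool" where
  "interlace_odd n a u \<longleftrightarrow>
     (\<forall>j\<in>{1..u}. \<not> (2 * u + 1 = n \<and> j = 1) \<longrightarrow> a (2 * u + 1) j \<ge> a (2 * u) j) \<and>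
     (\<forall>j. 1 \<le> j \<and> j + 1 \<le> u \<longrightarrow> a (2 * u) j \<ge> a (2 * u + 1) (j + 1)) \<and>
     (\<not> (2 * u + 1 = n \<and> u = 1) \<longrightarrow> a (2 * u) u \<ge> - a (2 * u + 1) u)"

definition interlace_even :: "nat \<Rightarrow> pat \<Rightarrow> nat \<Rightarrow> bool" where
  "interlace_even n a u \<longleftrightarrow>
     (\<forall>j\<in>{1..u - 1}. \<not> (2 * u = n \<and> j = 1) \<longrightarrow> a (2 * u) j \<ge> a (2 * u - 1) j) \<and>
     (\<forall>j. 1 \<le> j \<and> j + 2 \<le> u \<longrightarrow> a (2 * u - 1) j \<ge> a (2 * u) (j + 1)) \<and>
     a (2 * u - 1) (u - 1) \<ge> \<bar>a (2 * u) u\<bar>"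

definition patterns :: "nat \<Rightarrow> bool \<Rightarrow> (nat \<Rightarrow> real) \<Rightarrow> pat set" where
  "patterns n ii m = {a.
     (\<forall>j\<in>{2..n div 2}. a n j = m j) \<and>
     (\<forall>(k, j)\<in>positions n. entry_ok ii (a k j)) \<and>
     (\<forall>k j. (k, j) \<notin> positions n \<longrightarrow> a k j = 0) \<and>
     (\<forall>u. 1 \<le> u \<and> 2 * u + 1 \<le> n \<longrightarrow> interlace_odd n a u) \<and>
     (\<forall>u. 2 \<le> u \<and> 2 * u \<le> n \<longrightarrow> interlace_even n a u)}"

definition shift :: "pat \<Rightarrow> nat \<Rightarrow> nat \<Rightarrow> real \<Rightarrow> pat" where
  "shift a k j d = a(k := (a k)(j := a k j + d))"

text \<open>
  The numbers \<open>l\<^sub>j\<^sub>k\<close>: the offset \<open>(k + 1) div 2 - j\<close> is \<open>u - j\<close> for \<open>k = 2 u\<close> and \<open>u - j + 1\<close> for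
  \<open>k = 2 u + 1\<close>. \<open>lreal\<close> must not be used at the first position of row \<open>n\<close>, where \<open>l = c\<close>.
\<close>

definition lreal :: "pat \<Rightarrow> nat \<Rightarrow> nat \<Rightarrow> real" where
  "lreal a k j = a k j + real ((k + 1) div 2) - real j"

definition lnum :: "nat \<Rightarrow> complex \<Rightarrow> pat \<Rightarrow> nat \<Rightarrow> nat \<Rightarrow> complex" where
  "lnum n c a k j = (if k = n \<and> j = 1 then c else complex_of_real (lreal a k j))"

text \<open>A choice of a square root \<open>w x\<close> of \<open>[c + x]\<close> for every \<open>x\<close> with \<open>2 x\<close> an integer.\<close>

definition root_choice :: "real \<Rightarrow> complex \<Rightarrow> (real \<Rightarrow> complex) \<Rightarrow> bool" where
  "root_choice h c w \<longleftrightarrow> (\<forall>x. 2 * x \<in> \<int> \<longrightarrow> (w x)\<^sup>2 = qnum h (c + complex_of_real x))"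

definition qsqrt :: "real \<Rightarrow> real \<Rightarrow> complex" where
  "qsqrt h x = complex_of_real (sqrt (qnum h x))"

text \<open>
  The square roots of \<open>[l\<^sub>r\<^sub>k + x]\<close> and \<open>[\<bar>l\<^sub>r\<^sub>k - x\<bar>]\<close>; if \<open>l\<^sub>r\<^sub>k = c\<close>, the chosen square roots of
  \<open>[c + x]\<close> and \<open>[c - x]\<close>.
\<close>

definition root_plus :: "real \<Rightarrow> nat \<Rightarrow> (real \<Rightarrow> complex) \<Rightarrow> pat \<Rightarrow> nat \<Rightarrow> nat \<Rightarrow> real \<Rightarrow> complex" where
  "root_plus h n w a k r x = (if k = n \<and> r = 1 then w x else qsqrt h (lreal a k r + x))"

definition root_minus :: "real \<Rightarrow> nat \<Rightarrow> (real \<Rightarrow> complex) \<Rightarrow> pat \<Rightarrow> nat \<Rightarrow> nat \<Rightarrow> real \<Rightarrow> complex" where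
  "root_minus h n w a k r x = (if k = n \<and> r = 1 then w (- x) else qsqrt h \<bar>lreal a k r - x\<bar>)"

definition coeffA :: "real \<Rightarrow> nat \<Rightarrow> (real \<Rightarrow> complex) \<Rightarrow> nat \<Rightarrow> nat \<Rightarrow> pat \<Rightarrow> complex" where
  "coeffA h n w u j a =
     (let y = lreal a (2 * u) j in
      complex_of_real (sqrt (qratio h y)) * complex_of_real (sqrt (qratio h (y + 1))) *
      ((\<Prod>r=1..u. root_plus h n w a (2 * u + 1) r y * root_minus h n w a (2 * u + 1) r (y + 1)) *
       (\<Prod>r=1..u - 1. qsqrt h (lreal a (2 * u - 1) r + y) * qsqrt h \<bar>lreal a (2 * u - 1) r - y - 1\<bar>)) /
      (\<Prod>r\<in>{1..u} - {j}.
         qsqrt h (lreal a (2 * u) r + y) * qsqrt h \<bar>lreal a (2 * u) r - y\<bar> *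
         qsqrt h (lreal a (2 * u) r + y + 1) * qsqrt h \<bar>lreal a (2 * u) r - y - 1\<bar>))"

definition coeffB :: "real \<Rightarrow> nat \<Rightarrow> (real \<Rightarrow> complex) \<Rightarrow> nat \<Rightarrow> nat \<Rightarrow> pat \<Rightarrow> complex" where
  "coeffB h n w u j a =
     (let y = lreal a (2 * u + 1) j in
      ((\<Prod>r=1..u + 1. root_plus h n w a (2 * u + 2) r y * root_minus h n w a (2 * u + 2) r y) *
       (\<Prod>r=1..u. qsqrt h (lreal a (2 * u) r + y) * qsqrt h \<bar>lreal a (2 * u) r - y\<bar>)) /
      (\<Prod>r\<in>{1..u} - {j}.
         qsqrt h (lreal a (2 * u + 1) r + y) * qsqrt h \<bar>lreal a (2 * u + 1) r - y\<bar> *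
         qsqrt h (lreal a (2 * u + 1) r + y - 1) * qsqrt h \<bar>lreal a (2 * u + 1) r - y - 1\<bar>) *
      (1 / (complex_of_real (qnum h y) * qsqrt h (2 * y + 1) * qsqrt h (2 * y - 1))))"

definition coeff_diag :: "real \<Rightarrow> nat \<Rightarrow> complex \<Rightarrow> nat \<Rightarrow> pat \<Rightarrow> complex" where
  "coeff_diag h n c u a =
     (if \<exists>r\<in>{1..u}. lreal a (2 * u + 1) r = 1 then 0
      else \<i> * ((\<Prod>r=1..u + 1. qnum h (lnum n c a (2 * u + 2) r)) *
                (\<Prod>r=1..u. complex_of_real (qnum h (lreal a (2 * u) r)))) /
           (\<Prod>r=1..u. complex_of_real (qnum h (lreal a (2 * u + 1) r) *
                                       qnum h (lreal a (2 * u + 1) r - 1))))"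

text \<open>
  Finite linear combinations of patterns are finitely supported functions, and \<open>single a z\<close> is \<open>z\<close>
  times the pattern \<open>a\<close>.
\<close>

type_synonym vec = "pat \<Rightarrow>\<^sub>0 complex"

definition term_in :: "pat set \<Rightarrow> pat \<Rightarrow> complex \<Rightarrow> vec" where
  "term_in P a z = (if a \<in> P then Poly_Mapping.single a z else 0)"

text \<open>The image of the pattern \<open>a\<close> under the operator representing \<open>I\<^sub>i\<^sub>,\<^sub>i\<^sub>-\<^sub>1\<close>.\<close>

definition gen_basis ::
  "real \<Rightarrow> nat \<Rightarrow> bool \<Rightarrow> (nat \<Rightarrow> real) \<Rightarrow> complex \<Rightarrow> (real \<Rightarrow> complex) \<Rightarrow> nat \<Rightarrow> pat \<Rightarrow> vec" where
  "gen_basis h n ii m c w i a =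
     (let P = patterns n ii m; u = (i - 1) div 2;
          up = (\<lambda>j. shift a (i - 1) j 1); down = (\<lambda>j. shift a (i - 1) j (- 1)) in
      if odd i then
        (\<Sum>j=1..u. term_in P (up j) (coeffA h n w u j a)) -
        (\<Sum>j=1..u. term_in P (down j) (coeffA h n w u j (down j)))
      else
        (\<Sum>j=1..u. term_in P (up j) (coeffB h n w u j a)) -
        (\<Sum>j=1..u. term_in P (down j) (coeffB h n w u j (down j))) +
        Poly_Mapping.single a (coeff_diag h n c u a))"

definition lin_ext :: "(pat \<Rightarrow> vec) \<Rightarrow> vec \<Rightarrow> vec" where
  "lin_ext t x = (\<Sum>a\<in>Poly_Mapping.keys x.
     Poly_Mapping.map (\<lambda>z. Poly_Mapping.lookup x a * z) (t a))"

definition rep_T ::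
  "real \<Rightarrow> nat \<Rightarrow> bool \<Rightarrow> (nat \<Rightarrow> real) \<Rightarrow> complex \<Rightarrow> (real \<Rightarrow> complex) \<Rightarrow> nat \<Rightarrow> vec \<Rightarrow> vec" where
  "rep_T h n ii m c w i = lin_ext (gen_basis h n ii m c w i)"

definition span_D :: "nat \<Rightarrow> bool \<Rightarrow> (nat \<Rightarrow> real) \<Rightarrow> vec set" where
  "span_D n ii m = {x. Poly_Mapping.keys x \<subseteq> patterns n ii m}"

text \<open>The inner product for which the patterns are orthonormal.\<close>

definition ip :: "vec \<Rightarrow> vec \<Rightarrow> complex" where
  "ip x y = (\<Sum>a\<in>Poly_Mapping.keys x.
     Poly_Mapping.lookup x a * cnj (Poly_Mapping.lookup y a))"

text \<open>
  Compatibility with the \<open>*\<close>-structure of \<open>U\<^sub>q(so\<^sub>n\<^sub>-\<^sub>1\<^sub>,\<^sub>1)\<close>; \<open>T i\<close> is the operator on \<open>D\<close> representing the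
  generator \<open>I\<^sub>i\<^sub>,\<^sub>i\<^sub>-\<^sub>1\<close>.
\<close>

definition unitary_on :: "nat \<Rightarrow> vec set \<Rightarrow> (nat \<Rightarrow> vec \<Rightarrow> vec) \<Rightarrow> bool" where
  "unitary_on n D T \<longleftrightarrow>
     (\<forall>i\<in>{2..n}. T i ` D \<subseteq> D) \<and>
     (\<forall>i\<in>{2..n - 1}. \<forall>x\<in>D. \<forall>y\<in>D. ip (T i x) y = - ip x (T i y)) \<and>
     (\<forall>x\<in>D. \<forall>y\<in>D. ip (T n x) y = ip x (T n y))"

definition T_unitary ::
  "real \<Rightarrow> nat \<Rightarrow> bool \<Rightarrow> (nat \<Rightarrow> real) \<Rightarrow> complex \<Rightarrow> bool" where
  "T_unitary h n ii m c \<longleftrightarrow>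
     (\<forall>w. root_choice h c w \<longrightarrow> unitary_on n (span_D n ii m) (rep_T h n ii m c w))"

text \<open>The numbers \<open>l\<^sub>j\<close> of the top row, for \<open>n = 2 p + 1\<close> and for \<open>n = 2 p + 2\<close>.\<close>

definition ltop :: "nat \<Rightarrow> (nat \<Rightarrow> real) \<Rightarrow> nat \<Rightarrow> real" where
  "ltop p m j = m j + real p - real j + 1"

text \<open>
  The range of \<open>r\<close> is the one for which \<open>l\<close> is defined at \<open>p - r + 1\<close>. The interval
  \<open>1/2 < c < s + 1\<close> gives unitary representations for integral \<open>m\<close> only: for half-integral \<open>m\<close> there
  are patterns with the entry \<open>- 1 / 2\<close> at the last position of row \<open>2 p\<close>, and raising it has the
  coefficient \<open>[c - 1 / 2]\<close> times a positive factor, which for real \<open>c > 1 / 2\<close> is not imaginary.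
\<close>

definition suppl_s :: "nat \<Rightarrow> (nat \<Rightarrow> real) \<Rightarrow> nat" where
  "suppl_s p m =
     (if p = 1 \<or> ltop p m p > 1 then 0
      else Max {r \<in> {1..p - 1}. ltop p m (p - r + 1) = real r})"

end

theory Submission
  imports Defs
begin

text \<open>
  In the orthonormal basis of patterns every generator is a ladder operator: it raises one entry of
  a row by one with some coefficient, lowers it with minus the coefficient of the reverse move, and
  has a diagonal part. Such an operator is skew-symmetric exactly when the raising coefficients are
  real and the diagonal ones imaginary, and symmetric when it is the other way round
  (\<open>ladder_entry_adjoint\<close>, \<open>ip_lin_ext_adjoint\<close>). Unitarity is therefore a statement about the phases of
  the coefficients.

  For the compact generators \<open>I\<^sub>i\<^sub>,\<^sub>i\<^sub>-\<^sub>1\<close> with \<open>i < n\<close> the coefficients do not contain \<open>c\<close>: they are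
  products of real square roots, so skew-symmetry is automatic. In the last generator the
  coefficient is a real number times a square root of \<open>[c + y] [c - y - 1]\<close> if \<open>n\<close> is odd and of
  \<open>[c + y] [c - y]\<close> if \<open>n\<close> is even. With \<open>d = c - 1/2\<close>, \<open>z = y + 1/2\<close> in the odd case and \<open>d = c\<close>,
  \<open>z = y\<close> in the even case, this is \<open>[d + z] [d - z]\<close>, a positive multiple of
  \<open>cosh (h d) - cosh (h z)\<close> (\<open>qnum_mult_symmetric\<close>). It has imaginary square roots as soon as
  \<open>cosh (h d)\<close> is a real number at most \<open>cosh (h z)\<close>. In the principal series \<open>cosh (h d)\<close> is a
  cosine, hence at most one, and in the strange series it is \<open>- cosh (h Re d)\<close>. In the
  supplementary series it is \<open>cosh (h d)\<close> with real \<open>d\<close>, and the inequality can fail only for the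
  finitely many \<open>z\<close> with \<open>\<bar>z\<bar> < d\<close>; for each of these, a factor coming from one of the
  smallest of the fixed \<open>l\<^sub>j\<close> makes the whole coefficient vanish. The diagonal
  part of the last generator is a real multiple of \<open>\<i> [c]\<close>, with \<open>[c]\<close> imaginary in the principal
  and strange series, and it contains the factor \<open>[0]\<close> in the supplementary series.
\<close>

section \<open>Adjoints of operators given on the basis of patterns\<close>

lemma lookup_lin_ext:
  "Poly_Mapping.lookup (lin_ext t x) b =
     (\<Sum>a\<in>Poly_Mapping.keys x. Poly_Mapping.lookup x a * Poly_Mapping.lookup (t a) b)"
  unfolding lin_ext_def lookup_sum
  by (intro sum.cong refl) (simp add: Poly_Mapping.map.rep_eq when_def)

lemma ip_eq_sum:
  assumes "finite S" "Poly_Mapping.keys x \<inter> Poly_Mapping.keys y \<subseteq> S"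
  shows "ip x y = (\<Sum>a\<in>S. Poly_Mapping.lookup x a * cnj (Poly_Mapping.lookup y a))"
  unfolding ip_def
proof (rule sum.mono_neutral_cong)
  show "finite S" by (fact assms(1))
  show "finite (Poly_Mapping.keys x)" by simp
qed (use assms(2) in \<open>auto simp: in_keys_iff\<close>)

lemma ip_lin_ext_adjoint:
  assumes adj: "\<And>a b. a \<in> P \<Longrightarrow> b \<in> P \<Longrightarrow>
      Poly_Mapping.lookup (t a) b = \<epsilon> * cnj (Poly_Mapping.lookup (t b) a)"
    and x: "Poly_Mapping.keys x \<subseteq> P" and y: "Poly_Mapping.keys y \<subseteq> P"
  shows "ip (lin_ext t x) y = \<epsilon> * ip x (lin_ext t y)"
proof -
  let ?X = "Poly_Mapping.keys x" and ?Y = "Poly_Mapping.keys y"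
  have "ip (lin_ext t x) y =
      (\<Sum>b\<in>?Y. Poly_Mapping.lookup (lin_ext t x) b * cnj (Poly_Mapping.lookup y b))"
    by (rule ip_eq_sum) auto
  also have "\<dots> = (\<Sum>b\<in>?Y. \<Sum>a\<in>?X. Poly_Mapping.lookup x a * Poly_Mapping.lookup (t a) b *
      cnj (Poly_Mapping.lookup y b))"
    by (simp add: lookup_lin_ext sum_distrib_right)
  also have "\<dots> = (\<Sum>b\<in>?Y. \<Sum>a\<in>?X. \<epsilon> * (Poly_Mapping.lookup x a *
      cnj (Poly_Mapping.lookup y b * Poly_Mapping.lookup (t b) a)))"
  proof (intro sum.cong refl)
    fix a b assume "b \<in> ?Y" "a \<in> ?X"
    then show "Poly_Mapping.lookup x a * Poly_Mapping.lookup (t a) b * cnj (Poly_Mapping.lookup y b) =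
        \<epsilon> * (Poly_Mapping.lookup x a * cnj (Poly_Mapping.lookup y b * Poly_Mapping.lookup (t b) a))"
      using adj[of a b] x y by auto
  qed
  also have "\<dots> = (\<Sum>a\<in>?X. \<Sum>b\<in>?Y. \<epsilon> * (Poly_Mapping.lookup x a *
      cnj (Poly_Mapping.lookup y b * Poly_Mapping.lookup (t b) a)))"
    by (rule sum.swap)
  also have "\<dots> = \<epsilon> * ip x (lin_ext t y)"
    by (simp add: ip_def lookup_lin_ext sum_distrib_left)
  finally show ?thesis .
qed

lemma keys_lin_ext:
  assumes "\<And>a. a \<in> P \<Longrightarrow> Poly_Mapping.keys (t a) \<subseteq> P" "Poly_Mapping.keys x \<subseteq> P"
  shows "Poly_Mapping.keys (lin_ext t x) \<subseteq> P"
proof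
  fix b assume "b \<in> Poly_Mapping.keys (lin_ext t x)"
  then have "(\<Sum>a\<in>Poly_Mapping.keys x. Poly_Mapping.lookup x a * Poly_Mapping.lookup (t a) b) \<noteq> 0"
    by (simp add: in_keys_iff lookup_lin_ext)
  then obtain a where "a \<in> Poly_Mapping.keys x" "Poly_Mapping.lookup (t a) b \<noteq> 0"
    by (metis (no_types, lifting) mult_zero_right sum.neutral)
  then show "b \<in> P" using assms by (meson in_keys_iff subsetD)
qed

section \<open>Ladder operators\<close>

text \<open>
  The common shape of the odd and the even generators; in the odd case \<open>d\<close> is zero.
\<close>

definition ladder ::
  "pat set \<Rightarrow> nat \<Rightarrow> nat \<Rightarrow> (nat \<Rightarrow> pat \<Rightarrow> complex) \<Rightarrow> (pat \<Rightarrow> complex) \<Rightarrow> pat \<Rightarrow> vec" where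
  "ladder P k u C d a =
     (\<Sum>j=1..u. term_in P (shift a k j 1) (C j a)) -
     (\<Sum>j=1..u. term_in P (shift a k j (- 1)) (C j (shift a k j (- 1)))) +
     Poly_Mapping.single a (d a)"

lemma gen_basis_odd:
  "odd i \<Longrightarrow> gen_basis h n ii m c w i =
     ladder (patterns n ii m) (i - 1) ((i - 1) div 2) (coeffA h n w ((i - 1) div 2)) (\<lambda>_. 0)"
  by (rule ext) (simp add: gen_basis_def ladder_def Let_def)

lemma gen_basis_even:
  "even i \<Longrightarrow> gen_basis h n ii m c w i =
     ladder (patterns n ii m) (i - 1) ((i - 1) div 2) (coeffB h n w ((i - 1) div 2))
       (coeff_diag h n c ((i - 1) div 2))"
  by (rule ext) (simp add: gen_basis_def ladder_def Let_def)

lemma shift_down_eq_iff: "shift a k j (- 1) = b \<longleftrightarrow> shift b k j 1 = a"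
proof -
  have "shift (shift a k j d) k j (- d) = a" for a d
    by (simp add: shift_def)
  from this[of _ "- 1"] this[of _ 1] show ?thesis by auto
qed

lemma lookup_term_in:
  "Poly_Mapping.lookup (term_in P a z) b = (if a \<in> P \<and> a = b then z else 0)"
  by (auto simp: term_in_def lookup_single when_def)

lemma lookup_ladder:
  assumes "b \<in> P"
  shows "Poly_Mapping.lookup (ladder P k u C d a) b =
     (\<Sum>j=1..u. if shift a k j 1 = b then C j a else 0) -
     (\<Sum>j=1..u. if shift b k j 1 = a then C j b else 0) + (if a = b then d a else 0)"
proof -
  have "(if shift a k j (- 1) \<in> P \<and> shift a k j (- 1) = b then C j (shift a k j (- 1)) else 0) =
      (if shift b k j 1 = a then C j b else 0)" for j
    using assms shift_down_eq_iff[of a k j b] by auto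
  moreover have "(if shift a k j 1 \<in> P \<and> shift a k j 1 = b then C j a else 0) =
      (if shift a k j 1 = b then C j a else 0)" for j
    using assms by auto
  ultimately show ?thesis
    by (simp add: ladder_def lookup_add lookup_minus lookup_sum lookup_term_in lookup_single when_def)
qed

lemma keys_ladder:
  assumes "a \<in> P"
  shows "Poly_Mapping.keys (ladder P k u C d a) \<subseteq> P"
proof
  fix b assume b: "b \<in> Poly_Mapping.keys (ladder P k u C d a)"
  show "b \<in> P"
  proof (rule ccontr)
    assume nb: "b \<notin> P"
    then have "Poly_Mapping.lookup (term_in P a' z) b = 0" for a' z
      unfolding lookup_term_in by auto
    moreover have "a \<noteq> b" using assms nb by auto
    ultimately have "Poly_Mapping.lookup (ladder P k u C d a) b = 0"
      by (simp add: ladder_def lookup_add lookup_minus lookup_sum lookup_single when_def)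
    with b show False by (simp add: in_keys_iff)
  qed
qed

text \<open>
  The minus sign in front of the lowering terms turns conjugation of a raising coefficient into
  the opposite sign: \<open>\<epsilon> = - 1\<close> (skew-symmetry) asks for real and \<open>\<epsilon> = 1\<close> (symmetry) for imaginary
  coefficients.
\<close>

lemma ladder_entry_adjoint:
  fixes \<epsilon> :: complex
  assumes "a \<in> P" "b \<in> P" and \<epsilon>: "\<epsilon> * \<epsilon> = 1"
    and C: "\<And>a j. a \<in> P \<Longrightarrow> j \<in> {1..u} \<Longrightarrow> cnj (C j a) = - \<epsilon> * C j a"
    and d: "\<And>a. a \<in> P \<Longrightarrow> cnj (d a) = \<epsilon> * d a"
  shows "Poly_Mapping.lookup (ladder P k u C d a) b =
    \<epsilon> * cnj (Poly_Mapping.lookup (ladder P k u C d b) a)"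
proof -
  have cnj_sum_C: "cnj (\<Sum>j=1..u. if shift a k j 1 = b then C j a else 0) =
      - \<epsilon> * (\<Sum>j=1..u. if shift a k j 1 = b then C j a else 0)" if "a \<in> P" for a b
    using C[OF that] by (auto simp: cnj_sum sum_distrib_left intro!: sum.cong)
  have cancel: "\<epsilon> * (\<epsilon> * z) = z" for z
    using \<epsilon> by (simp add: mult.assoc[symmetric])
  have diag: "cnj (if b = a then d b else 0) = \<epsilon> * (if a = b then d a else 0)"
    using d[OF assms(1)] by auto
  show ?thesis
    unfolding lookup_ladder[OF assms(1)] lookup_ladder[OF assms(2)]
      complex_cnj_add complex_cnj_diff cnj_sum_C[OF assms(1)] cnj_sum_C[OF assms(2)] diag
    by (simp add: algebra_simps cancel)
qed

section \<open>Phases of the coefficients\<close>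

lemma cnj_Reals: "z \<in> \<real> \<Longrightarrow> cnj z = z"
  by (simp add: Reals_cnj_iff)

lemma qsqrt_Reals: "qsqrt h x \<in> \<real>"
  by (simp add: qsqrt_def)

lemma qnum_0: "qnum h 0 = 0"
  by (simp add: qnum_def)

lemma qsqrt_0 [simp]: "qsqrt h 0 = 0"
  by (simp add: qsqrt_def qnum_0)

lemma qnum_of_real: "qnum h (complex_of_real x) = complex_of_real (qnum h x)"
  by (simp add: qnum_def qpow_def exp_of_real[symmetric])

lemma root_plus_Reals: "\<not> (k = n \<and> r = 1) \<Longrightarrow> root_plus h n w a k r x \<in> \<real>"
  by (auto simp: root_plus_def qsqrt_Reals)

lemma root_minus_Reals: "\<not> (k = n \<and> r = 1) \<Longrightarrow> root_minus h n w a k r x \<in> \<real>"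
  by (auto simp: root_minus_def qsqrt_Reals)

lemmas coeff_Reals_intros =
  Reals_mult Reals_divide prod_in_Reals Reals_of_real Reals_1 qsqrt_Reals
  root_plus_Reals root_minus_Reals

lemma coeffA_Reals: "2 * u + 1 \<noteq> n \<Longrightarrow> coeffA h n w u j a \<in> \<real>"
  unfolding coeffA_def Let_def by (intro coeff_Reals_intros) auto

lemma coeffB_Reals: "2 * u + 2 \<noteq> n \<Longrightarrow> coeffB h n w u j a \<in> \<real>"
  unfolding coeffB_def Let_def by (intro coeff_Reals_intros) auto

lemma cnj_coeff_diag:
  assumes "2 * u + 2 \<noteq> n"
  shows "cnj (coeff_diag h n c u a) = - coeff_diag h n c u a"
  using assms
  by (simp add: coeff_diag_def lnum_def qnum_of_real)

text \<open>
  In the last generator the first factor of the product over row \<open>n\<close> carries \<open>c\<close>; splitting it off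
  leaves a real number.
\<close>

lemma coeffA_top:
  assumes "p \<ge> 1"
  defines "n \<equiv> 2 * p + 1"
  shows "\<exists>R\<in>\<real>. coeffA h n w p j a =
    w (lreal a (2 * p) j) * w (- (lreal a (2 * p) j + 1)) * R"
proof -
  define y where "y = lreal a (2 * p) j"
  define Q where "Q = (\<Prod>r=2..p. root_plus h n w a (2 * p + 1) r y *
    root_minus h n w a (2 * p + 1) r (y + 1))"
  define R where "R = complex_of_real (sqrt (qratio h y)) * complex_of_real (sqrt (qratio h (y + 1))) *
      (Q * (\<Prod>r=1..p - 1. qsqrt h (lreal a (2 * p - 1) r + y) *
         qsqrt h \<bar>lreal a (2 * p - 1) r - y - 1\<bar>)) /
      (\<Prod>r\<in>{1..p} - {j}.
         qsqrt h (lreal a (2 * p) r + y) * qsqrt h \<bar>lreal a (2 * p) r - y\<bar> *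
         qsqrt h (lreal a (2 * p) r + y + 1) * qsqrt h \<bar>lreal a (2 * p) r - y - 1\<bar>)"
  have split: "(\<Prod>r=1..p. root_plus h n w a (2 * p + 1) r y * root_minus h n w a (2 * p + 1) r (y + 1))
      = w y * w (- (y + 1)) * Q"
    using assms(1)
    by (simp add: Q_def prod.atLeast_Suc_atMost n_def root_plus_def root_minus_def numeral_2_eq_2)
  have "R \<in> \<real>"
    unfolding R_def Q_def by (intro coeff_Reals_intros) auto
  moreover have "coeffA h n w p j a = w y * w (- (y + 1)) * R"
    unfolding coeffA_def Let_def y_def[symmetric] split by (simp add: R_def)
  ultimately show ?thesis unfolding y_def by blast
qed

lemma coeffA_top_eq_0:
  assumes "r \<in> {2..p}" and "n = 2 * p + 1"
    and "lreal a n r = - lreal a (2 * p) j \<or> lreal a n r = lreal a (2 * p) j + 1"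
  shows "coeffA h n w p j a = 0"
proof -
  have "(\<Prod>r=1..p. root_plus h n w a (2 * p + 1) r (lreal a (2 * p) j) *
      root_minus h n w a (2 * p + 1) r (lreal a (2 * p) j + 1)) = 0"
    using assms by (intro prod_zero bexI[of _ r]) (auto simp: root_plus_def root_minus_def)
  then show ?thesis by (simp add: coeffA_def Let_def)
qed

lemma coeffB_top:
  fixes p
  defines "n \<equiv> 2 * p + 2"
  shows "\<exists>R\<in>\<real>. coeffB h n w p j a =
    w (lreal a (2 * p + 1) j) * w (- lreal a (2 * p + 1) j) * R"
proof -
  define y where "y = lreal a (2 * p + 1) j"
  define Q where "Q = (\<Prod>r=2..p + 1. root_plus h n w a (2 * p + 2) r y *
    root_minus h n w a (2 * p + 2) r y)"
  define R where "R =
      (Q * (\<Prod>r=1..p. qsqrt h (lreal a (2 * p) r + y) * qsqrt h \<bar>lreal a (2 * p) r - y\<bar>)) /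
      (\<Prod>r\<in>{1..p} - {j}.
         qsqrt h (lreal a (2 * p + 1) r + y) * qsqrt h \<bar>lreal a (2 * p + 1) r - y\<bar> *
         qsqrt h (lreal a (2 * p + 1) r + y - 1) * qsqrt h \<bar>lreal a (2 * p + 1) r - y - 1\<bar>) *
      (1 / (complex_of_real (qnum h y) * qsqrt h (2 * y + 1) * qsqrt h (2 * y - 1)))"
  have split: "(\<Prod>r=1..p + 1. root_plus h n w a (2 * p + 2) r y * root_minus h n w a (2 * p + 2) r y)
      = w y * w (- y) * Q"
    by (subst prod.atLeast_Suc_atMost)
      (simp_all add: Q_def n_def root_plus_def root_minus_def numeral_2_eq_2)
  have "R \<in> \<real>"
    unfolding R_def Q_def by (intro coeff_Reals_intros) auto
  moreover have "coeffB h n w p j a = w y * w (- y) * R"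
    unfolding coeffB_def Let_def y_def[symmetric] split by (simp add: R_def)
  ultimately show ?thesis unfolding y_def by blast
qed

lemma coeffB_top_eq_0:
  assumes "r \<in> {2..p + 1}" and "n = 2 * p + 2"
    and "lreal a n r = - lreal a (2 * p + 1) j \<or> lreal a n r = lreal a (2 * p + 1) j"
  shows "coeffB h n w p j a = 0"
proof -
  have "(\<Prod>r=1..p + 1. root_plus h n w a (2 * p + 2) r (lreal a (2 * p + 1) j) *
      root_minus h n w a (2 * p + 2) r (lreal a (2 * p + 1) j)) = 0"
    using assms by (intro prod_zero bexI[of _ r]) (auto simp: root_plus_def root_minus_def)
  then show ?thesis unfolding coeffB_def Let_def by simp
qed

lemma cnj_coeff_diag_top:
  assumes n: "n = 2 * p + 2"
    and c: "cnj (qnum h c) = - qnum h c \<or> (\<exists>r\<in>{2..p + 1}. lreal a n r = 0)"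
  shows "cnj (coeff_diag h n c p a) = coeff_diag h n c p a"
proof -
  have split: "(\<Prod>r=1..p + 1. qnum h (lnum n c a (2 * p + 2) r)) =
      qnum h c * (\<Prod>r=2..p + 1. complex_of_real (qnum h (lreal a n r)))"
  proof -
    have "(\<Prod>r=2..p + 1. qnum h (lnum n c a (2 * p + 2) r)) =
        (\<Prod>r=2..p + 1. complex_of_real (qnum h (lreal a n r)))"
      by (intro prod.cong refl) (auto simp: lnum_def n qnum_of_real)
    moreover have "qnum h (lnum n c a (2 * p + 2) 1) = qnum h c"
      by (simp add: lnum_def n)
    ultimately show ?thesis
      by (subst prod.atLeast_Suc_atMost) (simp_all add: numeral_2_eq_2)
  qed
  from c show ?thesis
  proof
    assume "cnj (qnum h c) = - qnum h c"
    then show ?thesis unfolding coeff_diag_def split by simp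
  next
    assume "\<exists>r\<in>{2..p + 1}. lreal a n r = 0"
    then obtain r where "r \<in> {2..p + 1}" "lreal a n r = 0" by blast
    then have "(\<Prod>r=2..p + 1. complex_of_real (qnum h (lreal a n r))) = 0"
      by (intro prod_zero bexI[of _ r]) (auto simp: qnum_0)
    then show ?thesis unfolding coeff_diag_def split by simp
  qed
qed

section \<open>The factors containing the continuous parameter\<close>

text \<open>
  The product of two hyperbolic sines is half a difference of hyperbolic cosines. Thus only
  \<open>cosh (h d)\<close> matters for the phase, which is real on the three lines of the unitary series.
\<close>

lemma qnum_mult_symmetric:
  fixes d z :: complex
  shows "qnum h (d + z) * qnum h (d - z) =
    2 * (cosh (of_real h * d) - cosh (of_real h * z)) /
      complex_of_real ((exp (h / 2) - exp (- h / 2))\<^sup>2)"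
proof -
  let ?e = "\<lambda>x :: complex. exp (of_real h * x / 2)"
  have e: "?e x * ?e y = exp (of_real h * (x + y) / 2)" for x y
    by (simp add: exp_add[symmetric] algebra_simps add_divide_distrib)
  have "(?e (d + z) - ?e (- (d + z))) * (?e (d - z) - ?e (- (d - z))) =
      ?e (d + z) * ?e (d - z) - ?e (d + z) * ?e (- (d - z)) - ?e (- (d + z)) * ?e (d - z)
        + ?e (- (d + z)) * ?e (- (d - z))"
    by (simp add: algebra_simps)
  also have "\<dots> = exp (of_real h * d) - exp (of_real h * z) - exp (- (of_real h * z))
      + exp (- (of_real h * d))"
    unfolding e by (simp add: algebra_simps)
  also have "\<dots> = 2 * (cosh (of_real h * d) - cosh (of_real h * z))"
    by (simp add: cosh_field_def field_simps)
  finally show ?thesis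
    by (simp add: qnum_def qpow_def exp_of_real[symmetric] power2_eq_square)
qed

lemma cnj_eq_uminus_of_square:
  assumes "z\<^sup>2 = complex_of_real s" "s \<le> 0"
  shows "cnj z = - z"
proof -
  have "(Re z)\<^sup>2 - (Im z)\<^sup>2 = s" "2 * Re z * Im z = 0"
    using arg_cong[OF assms(1), of Re] arg_cong[OF assms(1), of Im]
    by (auto simp: Re_power2 Im_power2)
  with assms(2) have "Re z = 0" by (cases "Im z = 0") auto
  then show ?thesis by (simp add: complex_eq_iff)
qed

lemma cosh_real: "cosh (of_real h * of_real x) = complex_of_real (cosh (h * x))"
  by (simp add: cosh_field_def exp_of_real[symmetric] exp_minus)

lemma cnj_root_pair:
  assumes "(w1 :: complex)\<^sup>2 = qnum h (d + of_real z)" "w2\<^sup>2 = qnum h (d - of_real z)"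
    and "cosh (of_real h * d) = complex_of_real g" "g \<le> cosh (h * z)"
  shows "cnj (w1 * w2) = - (w1 * w2)"
proof (rule cnj_eq_uminus_of_square)
  show "(w1 * w2)\<^sup>2 =
      complex_of_real (2 * (g - cosh (h * z)) / (exp (h / 2) - exp (- h / 2))\<^sup>2)"
    by (simp add: power_mult_distrib assms(1-3) qnum_mult_symmetric cosh_real)
  show "2 * (g - cosh (h * z)) / (exp (h / 2) - exp (- h / 2))\<^sup>2 \<le> 0"
    using assms(4) by (simp add: divide_nonpos_nonneg)
qed

lemma exp_imaginary: "exp (of_real h * (\<i> * of_real t) / 2) = cis (h * t / 2)"
  by (simp add: cis_conv_exp algebra_simps)

lemma cosh_imaginary: "cosh (of_real h * (\<i> * of_real t)) = complex_of_real (cos (h * t))"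
proof -
  have "of_real h * (\<i> * of_real t) = \<i> * of_real (h * t)" by simp
  moreover have "- (of_real h * (\<i> * of_real t)) = \<i> * of_real (- (h * t))" by simp
  ultimately show ?thesis
    unfolding cosh_field_def by (simp only: cis_conv_exp[symmetric]) (simp add: complex_eq_iff)
qed

lemma cosh_strange:
  assumes "h > 0" "Im d = pi / h"
  shows "cosh (of_real h * d) = complex_of_real (- cosh (h * Re d))"
proof -
  have "of_real h * d = of_real (h * Re d) + \<i> * of_real pi"
    using assms by (simp add: complex_eq_iff)
  then show ?thesis
    by (simp add: cosh_field_def exp_add exp_diff exp_of_real[symmetric] exp_minus field_simps)
qed

lemma cnj_qnum_imaginary: "cnj (qnum h (\<i> * of_real t)) = - qnum h (\<i> * of_real t)"
proof -
  have "qnum h (\<i> * of_real t) =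
      \<i> * of_real (2 * sin (h * t / 2) / (exp (h / 2) - exp (- h / 2)))"
    using exp_imaginary[of h t] exp_imaginary[of h "- t"]
    by (simp add: qnum_def qpow_def exp_of_real[symmetric] complex_eq_iff)
  then show ?thesis by simp
qed

lemma cnj_qnum_strange:
  assumes "h > 0" "Im c = pi / h"
  shows "cnj (qnum h c) = - qnum h c"
proof -
  have c: "of_real h * c / 2 = of_real (h * Re c / 2) + \<i> * of_real (pi / 2)"
    using assms by (simp add: complex_eq_iff)
  have "exp (of_real h * c / 2) = \<i> * of_real (exp (h * Re c / 2))"
    unfolding c exp_add by (simp only: exp_of_real cis_conv_exp[symmetric]) simp
  moreover have "exp (- (of_real h * c / 2)) = - \<i> * of_real (exp (- (h * Re c / 2)))"
    unfolding exp_minus calculation by (simp add: exp_minus field_simps)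
  ultimately have "qnum h c = \<i> * of_real ((exp (h * Re c / 2) + exp (- (h * Re c / 2))) /
      (exp (h / 2) - exp (- h / 2)))"
    by (simp add: qnum_def qpow_def exp_of_real[symmetric] distrib_left)
  then show ?thesis by simp
qed

section \<open>Criteria for unitarity\<close>

text \<open>
  Only row \<open>n\<close> contains \<open>c\<close>, so that the compact generators are skew-symmetric for every \<open>c\<close> and the
  symmetry of the last one is all that remains.
\<close>

lemma T_unitary_from_top:
  assumes n: "n \<ge> 2"
    and top: "\<And>w a b. root_choice h c w \<Longrightarrow> a \<in> patterns n ii m \<Longrightarrow> b \<in> patterns n ii m \<Longrightarrow>
      Poly_Mapping.lookup (gen_basis h n ii m c w n a) b =
        cnj (Poly_Mapping.lookup (gen_basis h n ii m c w n b) a)"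
  shows "T_unitary h n ii m c"
proof -
  let ?P = "patterns n ii m"
  have closed: "Poly_Mapping.keys (gen_basis h n ii m c w i a) \<subseteq> ?P" if "a \<in> ?P" for w i a
    using keys_ladder[OF that] by (cases "odd i") (simp_all add: gen_basis_odd gen_basis_even)
  have compact: "Poly_Mapping.lookup (gen_basis h n ii m c w i a) b =
      - 1 * cnj (Poly_Mapping.lookup (gen_basis h n ii m c w i b) a)"
    if "a \<in> ?P" "b \<in> ?P" "i \<in> {2..n - 1}" for w i a b
  proof (cases "odd i")
    case True
    then have "2 * ((i - 1) div 2) + 1 \<noteq> n" using that(3) by auto
    then show ?thesis
      unfolding gen_basis_odd[OF True]
      by (intro ladder_entry_adjoint that(1,2)) (auto simp: cnj_Reals coeffA_Reals)
  next
    case False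
    then have even: "even i" by simp
    then have "2 * ((i - 1) div 2) + 2 \<noteq> n" using that(3) by (auto elim!: evenE)
    then show ?thesis
      unfolding gen_basis_even[OF even]
      by (intro ladder_entry_adjoint that(1,2)) (auto simp: cnj_Reals coeffB_Reals cnj_coeff_diag)
  qed
  show ?thesis
    unfolding T_unitary_def unitary_on_def rep_T_def span_D_def
  proof (intro allI impI conjI ballI)
    fix w i
    show "lin_ext (gen_basis h n ii m c w i) ` {x. Poly_Mapping.keys x \<subseteq> ?P}
        \<subseteq> {x. Poly_Mapping.keys x \<subseteq> ?P}"
    proof
      fix v assume "v \<in> lin_ext (gen_basis h n ii m c w i) ` {x. Poly_Mapping.keys x \<subseteq> ?P}"
      then obtain x where "v = lin_ext (gen_basis h n ii m c w i) x" "Poly_Mapping.keys x \<subseteq> ?P"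
        by auto
      then show "v \<in> {x. Poly_Mapping.keys x \<subseteq> ?P}"
        using keys_lin_ext[of ?P "gen_basis h n ii m c w i" x] closed by simp
    qed
  next
    fix w i and x y :: vec assume i: "i \<in> {2..n - 1}" and xy: "x \<in> {x. Poly_Mapping.keys x \<subseteq> ?P}"
      "y \<in> {x. Poly_Mapping.keys x \<subseteq> ?P}"
    have "ip (lin_ext (gen_basis h n ii m c w i) x) y =
        - 1 * ip x (lin_ext (gen_basis h n ii m c w i) y)"
    proof (rule ip_lin_ext_adjoint)
      show "Poly_Mapping.keys x \<subseteq> ?P" "Poly_Mapping.keys y \<subseteq> ?P" using xy by auto
    qed (rule compact[OF _ _ i])
    then show "ip (lin_ext (gen_basis h n ii m c w i) x) y =
        - ip x (lin_ext (gen_basis h n ii m c w i) y)"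
      by simp
  next
    fix w and x y :: vec assume w: "root_choice h c w" and xy: "x \<in> {x. Poly_Mapping.keys x \<subseteq> ?P}"
      "y \<in> {x. Poly_Mapping.keys x \<subseteq> ?P}"
    have "ip (lin_ext (gen_basis h n ii m c w n) x) y =
        1 * ip x (lin_ext (gen_basis h n ii m c w n) y)"
    proof (rule ip_lin_ext_adjoint)
      show "Poly_Mapping.keys x \<subseteq> ?P" "Poly_Mapping.keys y \<subseteq> ?P" using xy by auto
    qed (unfold mult_1_left, rule top[OF w])
    then show "ip (lin_ext (gen_basis h n ii m c w n) x) y =
        ip x (lin_ext (gen_basis h n ii m c w n) y)"
      by simp
  qed
qed

lemma entry_ok_add_Ints: "entry_ok ii x \<Longrightarrow> k \<in> \<int> \<Longrightarrow> entry_ok ii (x + k)"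
  using Ints_add[of "x - 1 / 2" k] by (auto simp: entry_ok_def algebra_simps)

lemma entry_ok_double: "entry_ok ii x \<Longrightarrow> 2 * x \<in> \<int>"
proof (cases ii)
  case False
  assume "entry_ok ii x"
  then have "2 * (x - 1 / 2) + 1 \<in> \<int>"
    using False by (intro Ints_add Ints_mult) (auto simp: entry_ok_def)
  then show ?thesis by simp
qed (simp add: entry_ok_def)

lemma entry_ok_lreal:
  assumes "a \<in> patterns n ii m" "(k, j) \<in> positions n"
  shows "entry_ok ii (lreal a k j)"
proof -
  have "entry_ok ii (a k j)" using assms by (auto simp: patterns_def)
  from entry_ok_add_Ints[OF this, of "real ((k + 1) div 2) - real j"]
  show ?thesis by (simp add: lreal_def add_diff_eq)
qed

lemma lreal_top:
  assumes "a \<in> patterns n ii m" "n = 2 * p + 1 \<or> n = 2 * p + 2" "r \<in> {2..n div 2}"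
  shows "lreal a n r = ltop p m r"
  using assms by (auto simp: patterns_def lreal_def ltop_def)

text \<open>
  The first alternative makes the square root of \<open>[c + y] [c - y - 1]\<close> imaginary, the second one
  makes another factor of the coefficient zero.
\<close>

lemma T_unitary_odd:
  assumes p: "p \<ge> 1" and g: "cosh (of_real h * (c - 1 / 2)) = complex_of_real g"
    and y: "\<And>y. entry_ok ii y \<Longrightarrow> g \<le> cosh (h * (y + 1 / 2)) \<or>
      (\<exists>r\<in>{2..p}. ltop p m r = - y \<or> ltop p m r = y + 1)"
  shows "T_unitary h (2 * p + 1) ii m c"
proof (rule T_unitary_from_top)
  show "2 * p + 1 \<ge> 2" using p by simp
next
  define n where "n = 2 * p + 1"
  fix w a b
  assume w: "root_choice h c w"
  assume ab: "a \<in> patterns (2 * p + 1) ii m" "b \<in> patterns (2 * p + 1) ii m"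
  have imaginary: "cnj (coeffA h n w p j a) = - coeffA h n w p j a"
    if a: "a \<in> patterns n ii m" and j: "j \<in> {1..p}" for a j
  proof -
    define y where "y = lreal a (2 * p) j"
    have ok: "entry_ok ii y"
      unfolding y_def using j by (intro entry_ok_lreal[OF a]) (auto simp: positions_def n_def)
    from assms(3)[OF ok] show ?thesis
    proof
      assume le: "g \<le> cosh (h * (y + 1 / 2))"
      obtain R where R: "R \<in> \<real>" "coeffA h n w p j a = w y * w (- (y + 1)) * R"
        using coeffA_top[OF p] unfolding n_def y_def by blast
      have y2: "2 * y \<in> \<int>" by (rule entry_ok_double[OF ok])
      have "2 * (- (y + 1)) \<in> \<int>"
        using Ints_minus[OF Ints_add[OF y2, of 2]] by (simp add: algebra_simps)
      then have "(w y)\<^sup>2 = qnum h (c - 1 / 2 + of_real (y + 1 / 2))"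
        "(w (- (y + 1)))\<^sup>2 = qnum h (c - 1 / 2 - of_real (y + 1 / 2))"
        using w y2 unfolding root_choice_def by (auto simp: algebra_simps)
      from cnj_root_pair[OF this g le] R show ?thesis
        by (simp add: cnj_Reals)
    next
      assume "\<exists>r\<in>{2..p}. ltop p m r = - y \<or> ltop p m r = y + 1"
      then obtain r where r: "r \<in> {2..p}" "ltop p m r = - y \<or> ltop p m r = y + 1" by blast
      then have "lreal a n r = ltop p m r" by (intro lreal_top[OF a]) (auto simp: n_def)
      with r have "coeffA h n w p j a = 0"
        by (intro coeffA_top_eq_0[OF r(1) n_def]) (auto simp: y_def)
      then show ?thesis by simp
    qed
  qed
  have "Poly_Mapping.lookup (gen_basis h n ii m c w n a) b =
      1 * cnj (Poly_Mapping.lookup (gen_basis h n ii m c w n b) a)"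
  proof -
    have n: "odd n" "(n - 1) div 2 = p" by (auto simp: n_def)
    show ?thesis
      unfolding gen_basis_odd[OF n(1)] n(2)
      by (intro ladder_entry_adjoint ab[folded n_def]) (auto simp: imaginary)
  qed
  then show "Poly_Mapping.lookup (gen_basis h (2 * p + 1) ii m c w (2 * p + 1) a) b =
      cnj (Poly_Mapping.lookup (gen_basis h (2 * p + 1) ii m c w (2 * p + 1) b) a)"
    by (simp add: n_def)
qed

lemma T_unitary_even:
  assumes g: "cosh (of_real h * c) = complex_of_real g"
    and y: "\<And>y. entry_ok ii y \<Longrightarrow> g \<le> cosh (h * y) \<or>
      (\<exists>r\<in>{2..p + 1}. ltop p m r = - y \<or> ltop p m r = y)"
    and diag: "cnj (qnum h c) = - qnum h c \<or> (\<exists>r\<in>{2..p + 1}. ltop p m r = 0)"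
  shows "T_unitary h (2 * p + 2) ii m c"
proof (rule T_unitary_from_top)
  show "2 * p + 2 \<ge> 2" by simp
next
  define n where "n = 2 * p + 2"
  fix w a b
  assume w: "root_choice h c w"
  assume ab: "a \<in> patterns (2 * p + 2) ii m" "b \<in> patterns (2 * p + 2) ii m"
  have top: "lreal a n r = ltop p m r" if "a \<in> patterns n ii m" "r \<in> {2..p + 1}" for a r
    using that by (intro lreal_top[OF that(1)]) (auto simp: n_def)
  have imaginary: "cnj (coeffB h n w p j a) = - coeffB h n w p j a"
    if a: "a \<in> patterns n ii m" and j: "j \<in> {1..p}" for a j
  proof -
    define y where "y = lreal a (2 * p + 1) j"
    have ok: "entry_ok ii y"
      unfolding y_def using j by (intro entry_ok_lreal[OF a]) (auto simp: positions_def n_def)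
    from assms(2)[OF ok] show ?thesis
    proof
      assume le: "g \<le> cosh (h * y)"
      obtain R where R: "R \<in> \<real>" "coeffB h n w p j a = w y * w (- y) * R"
        using coeffB_top unfolding n_def y_def by blast
      have y2: "2 * y \<in> \<int>" by (rule entry_ok_double[OF ok])
      then have "2 * (- y) \<in> \<int>" by simp
      then have "(w y)\<^sup>2 = qnum h (c + of_real y)" "(w (- y))\<^sup>2 = qnum h (c - of_real y)"
        using w y2 unfolding root_choice_def by auto
      from cnj_root_pair[OF this g le] R show ?thesis
        by (simp add: cnj_Reals)
    next
      assume "\<exists>r\<in>{2..p + 1}. ltop p m r = - y \<or> ltop p m r = y"
      then obtain r where r: "r \<in> {2..p + 1}" "ltop p m r = - y \<or> ltop p m r = y" by blast
      with top[OF a r(1)] have "coeffB h n w p j a = 0"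
        by (intro coeffB_top_eq_0[OF r(1) n_def]) (auto simp: y_def)
      then show ?thesis by simp
    qed
  qed
  have diagonal: "cnj (coeff_diag h n c p a) = coeff_diag h n c p a" if "a \<in> patterns n ii m" for a
    using diag top[OF that] by (intro cnj_coeff_diag_top[OF n_def]) auto
  have "Poly_Mapping.lookup (gen_basis h n ii m c w n a) b =
      1 * cnj (Poly_Mapping.lookup (gen_basis h n ii m c w n b) a)"
  proof -
    have n: "even n" "(n - 1) div 2 = p" by (auto simp: n_def)
    show ?thesis
      unfolding gen_basis_even[OF n(1)] n(2)
      by (intro ladder_entry_adjoint ab[folded n_def]) (auto simp: imaginary diagonal)
  qed
  then show "Poly_Mapping.lookup (gen_basis h (2 * p + 2) ii m c w (2 * p + 2) a) b =
      cnj (Poly_Mapping.lookup (gen_basis h (2 * p + 2) ii m c w (2 * p + 2) b) a)"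
    by (simp add: n_def)
qed

section \<open>The supplementary series\<close>

lemma admissible_antimono:
  assumes "admissible n ii m" "2 \<le> i" "i \<le> j" "j \<le> n div 2"
  shows "m j \<le> m i"
  using assms(3,4)
proof (induction j rule: dec_induct)
  case (step j)
  then have "m (Suc j) \<le> m j" using assms(1,2) by (simp add: admissible_def)
  with step show ?case by simp
qed simp

text \<open>
  Since \<open>l\<^sub>p\<^sub>-\<^sub>r\<^sub>+\<^sub>1 = r\<close> says that \<open>m\<^sub>p\<^sub>-\<^sub>r\<^sub>+\<^sub>1\<close> vanishes, and the entries are decreasing and
  nonnegative, the equality at the largest \<open>r\<close> forces it at all smaller ones.
\<close>

lemma ltop_suppl_s:
  assumes adm: "admissible (2 * p + 1) ii m" and "p \<ge> 1" and r: "r \<in> {1..suppl_s p m}"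
  shows "r \<le> p - 1" "ltop p m (p - r + 1) = real r"
proof -
  define S where "S = {r \<in> {1..p - 1}. ltop p m (p - r + 1) = real r}"
  have p2: "p \<ge> 2" and le: "ltop p m p \<le> 1" and s: "suppl_s p m = Max S"
    using r \<open>p \<ge> 1\<close> by (auto simp: suppl_s_def S_def split: if_splits)
  have nonneg: "m p \<ge> 0" using adm p2 by (simp add: admissible_def)
  have "1 \<in> S" using p2 le nonneg by (auto simp: S_def ltop_def)
  then have "Max S \<in> S" by (intro Max_in) (auto simp: S_def)
  then have M: "suppl_s p m \<le> p - 1" "ltop p m (p - suppl_s p m + 1) = real (suppl_s p m)"
    by (auto simp: s S_def)
  show "r \<le> p - 1" using r M(1) by simp
  have "m p \<le> m (p - r + 1)"
    using r M(1) p2 by (intro admissible_antimono[OF adm]) auto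
  moreover have "m (p - r + 1) \<le> m (p - suppl_s p m + 1)"
    using r M(1) p2 by (intro admissible_antimono[OF adm]) auto
  moreover have "m (p - suppl_s p m + 1) = 0"
    using M p2 by (simp add: ltop_def of_nat_diff)
  ultimately have "m (p - r + 1) = 0" using nonneg by simp
  moreover have "real (p - r) = real p - real r" using r M(1) by (intro of_nat_diff) auto
  ultimately show "ltop p m (p - r + 1) = real r" by (simp add: ltop_def)
qed

lemma cosh_le_cosh_abs:
  fixes x z :: real
  assumes "h > 0" "\<bar>x\<bar> \<le> \<bar>z\<bar>"
  shows "cosh (h * x) \<le> cosh (h * z)"
proof -
  have "cosh \<bar>h * x\<bar> \<le> cosh \<bar>h * z\<bar>"
    using assms by (subst cosh_real_nonneg_le_iff) (auto simp: abs_mult)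
  then show ?thesis by simp
qed

text \<open>
  The bad values \<open>\<bar>y + 1/2\<bar> < s + 1/2\<close> are the integers from \<open>- s\<close> to \<open>s - 1\<close>, and each of them is
  \<open>- l\<close> or \<open>l - 1\<close> for one of the fixed values \<open>l = 1, \<dots>, s\<close>.
\<close>

lemma T_unitary_suppl_odd:
  assumes "h > 0" "p \<ge> 1" and adm: "admissible (2 * p + 1) True m"
    and x: "1 / 2 < x" "x < real (suppl_s p m) + 1"
  shows "T_unitary h (2 * p + 1) True m (complex_of_real x)"
proof (rule T_unitary_odd[where g = "cosh (h * (x - 1 / 2))"])
  show "p \<ge> 1" by fact
  show "cosh (of_real h * (complex_of_real x - 1 / 2)) = complex_of_real (cosh (h * (x - 1 / 2)))"
    using cosh_real[of h "x - 1 / 2"] by simp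
  let ?s = "suppl_s p m"
  fix y assume "entry_ok True y"
  then obtain k where k: "y = of_int k" by (auto simp: entry_ok_def elim: Ints_cases)
  have l: "ltop p m (p - r + 1) = real r \<and> p - r + 1 \<in> {2..p}" if "1 \<le> r" "r \<le> ?s" for r
    using ltop_suppl_s[OF adm \<open>p \<ge> 1\<close>, of r] that by auto
  consider "k \<ge> int ?s" | "k < - int ?s" | "0 \<le> k" "k < int ?s" | "- int ?s \<le> k" "k < 0"
    by linarith
  then show "cosh (h * (x - 1 / 2)) \<le> cosh (h * (y + 1 / 2)) \<or>
      (\<exists>r\<in>{2..p}. ltop p m r = - y \<or> ltop p m r = y + 1)"
  proof cases
    case 1
    then have "real ?s \<le> y" by (simp add: k)
    then show ?thesis using x by (intro disjI1 cosh_le_cosh_abs[OF \<open>h > 0\<close>]) auto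
  next
    case 2
    then have "y \<le> - real ?s - 1" by (simp add: k)
    then show ?thesis using x by (intro disjI1 cosh_le_cosh_abs[OF \<open>h > 0\<close>]) auto
  next
    case 3
    then have "1 \<le> nat (k + 1)" "nat (k + 1) \<le> ?s" "real (nat (k + 1)) = y + 1"
      by (auto simp: k)
    with l[of "nat (k + 1)"] show ?thesis by metis
  next
    case 4
    then have "1 \<le> nat (- k)" "nat (- k) \<le> ?s" "real (nat (- k)) = - y"
      by (auto simp: k)
    with l[of "nat (- k)"] show ?thesis by metis
  qed
qed

text \<open>
  The condition at \<open>r = 1\<close> says that \<open>l\<^sub>p\<^sub>+\<^sub>1 = 0\<close>, which makes the data integral and the diagonal
  part zero.
\<close>

lemma T_unitary_suppl_even:
  assumes "h > 0" "p \<ge> 1" and adm: "admissible (2 * p + 2) ii m"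
    and s: "s \<le> p" "\<And>r. r \<in> {1..s} \<Longrightarrow> ltop p m (p - r + 2) = real r - 1"
    and x: "0 < x" "x < real s"
  shows "T_unitary h (2 * p + 2) ii m (complex_of_real x)"
proof (rule T_unitary_even[where g = "cosh (h * x)"])
  show "cosh (of_real h * complex_of_real x) = complex_of_real (cosh (h * x))"
    by (rule cosh_real)
  have s1: "s \<ge> 1" using x by (cases s) auto
  then have l0: "ltop p m (p + 1) = 0" using s(2)[of 1] \<open>p \<ge> 1\<close> by simp
  then show "cnj (qnum h (complex_of_real x)) = - qnum h (complex_of_real x) \<or>
      (\<exists>r\<in>{2..p + 1}. ltop p m r = 0)"
    using \<open>p \<ge> 1\<close> by (intro disjI2 bexI[of _ "p + 1"]) auto
  have ii: ii
  proof (rule ccontr)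
    assume "\<not> ii"
    moreover have "entry_ok ii (m (p + 1))" using adm \<open>p \<ge> 1\<close> by (auto simp: admissible_def)
    ultimately have "- 1 / 2 \<in> (\<int> :: real set)" using l0 by (simp add: entry_ok_def ltop_def)
    then obtain k :: int where "- 1 / 2 = real_of_int k" by (auto elim: Ints_cases)
    then have "real_of_int (2 * k) = real_of_int (- 1)" by simp
    then have "2 * k = - 1" by (simp only: of_int_eq_iff)
    then show False by presburger
  qed
  fix y assume "entry_ok ii y"
  then obtain k where k: "y = of_int k" using ii by (auto simp: entry_ok_def elim: Ints_cases)
  show "cosh (h * x) \<le> cosh (h * y) \<or> (\<exists>r\<in>{2..p + 1}. ltop p m r = - y \<or> ltop p m r = y)"
  proof (cases "\<bar>k\<bar> \<ge> int s")
    case True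
    then have "real s \<le> \<bar>y\<bar>" by (simp add: k)
    then show ?thesis using x by (intro disjI1 cosh_le_cosh_abs[OF \<open>h > 0\<close>]) auto
  next
    case False
    define r where "r = nat \<bar>k\<bar> + 1"
    have r: "r \<in> {1..s}" and rk: "real r - 1 = \<bar>y\<bar>" using False by (auto simp: r_def k)
    then have "ltop p m (p - r + 2) = - y \<or> ltop p m (p - r + 2) = y"
      using s(2)[of r] by auto
    moreover have "p - r + 2 \<in> {2..p + 1}" using r s(1) by auto
    ultimately show ?thesis by blast
  qed
qed

section \<open>The unitary series\<close>

theorem mainTheorem4:
  fixes h :: real and p :: nat
  assumes "h > 0" and "p \<ge> 1"
  shows
    "(\<forall>ii m. admissible (2 * p + 1) ii m \<longrightarrow>
        (\<forall>t. 0 < t \<and> t < 2 * pi / h \<longrightarrow>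
           T_unitary h (2 * p + 1) ii m (\<i> * complex_of_real t + 1 / 2)) \<and>
        (ii \<longrightarrow> T_unitary h (2 * p + 1) ii m (1 / 2)) \<and>
        (ii \<longrightarrow> (\<forall>x. 1 / 2 < x \<and> x < real (suppl_s p m) + 1 \<longrightarrow>
           T_unitary h (2 * p + 1) ii m (complex_of_real x))) \<and>
        (\<forall>c. Im c = pi / h \<and> Re c > 1 / 2 \<longrightarrow> T_unitary h (2 * p + 1) ii m c))
     \<and>
     (\<forall>ii m. admissible (2 * p + 2) ii m \<longrightarrow>
        (\<forall>t. 0 \<le> t \<and> t < 2 * pi / h \<longrightarrow>
           T_unitary h (2 * p + 2) ii m (\<i> * complex_of_real t)) \<and>
        (\<forall>s. s \<le> p \<and> (\<forall>r\<in>{1..s}. ltop p m (p - r + 2) = real r - 1) \<longrightarrow>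
           (\<forall>x. 0 < x \<and> x < real s \<longrightarrow>
              T_unitary h (2 * p + 2) ii m (complex_of_real x))) \<and>
        (\<forall>c. Im c = pi / h \<and> Re c > 0 \<longrightarrow> T_unitary h (2 * p + 2) ii m c))"
proof (intro conjI allI impI)
  fix ii m and t :: real
  assume "0 < t \<and> t < 2 * pi / h"
  show "T_unitary h (2 * p + 1) ii m (\<i> * complex_of_real t + 1 / 2)"
  proof (rule T_unitary_odd[OF \<open>p \<ge> 1\<close>, where g = "cos (h * t)"])
    show "cos (h * t) \<le> cosh (h * (y + 1 / 2)) \<or>
        (\<exists>r\<in>{2..p}. ltop p m r = - y \<or> ltop p m r = y + 1)" for y
      using order_trans[OF cos_le_one cosh_real_ge_1] by blast
  qed (simp add: cosh_imaginary)
next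
  fix ii m
  show "T_unitary h (2 * p + 1) ii m (1 / 2)"
    by (rule T_unitary_odd[OF \<open>p \<ge> 1\<close>, where g = 1]) (simp_all add: cosh_real_ge_1)
next
  fix ii m and x :: real
  assume "admissible (2 * p + 1) ii m" ii "1 / 2 < x \<and> x < real (suppl_s p m) + 1"
  then show "T_unitary h (2 * p + 1) ii m (complex_of_real x)"
    using T_unitary_suppl_odd[OF assms] by simp
next
  fix ii m c
  assume c: "Im c = pi / h \<and> Re c > 1 / 2"
  show "T_unitary h (2 * p + 1) ii m c"
  proof (rule T_unitary_odd[OF \<open>p \<ge> 1\<close>])
    show "cosh (of_real h * (c - 1 / 2)) = complex_of_real (- cosh (h * Re (c - 1 / 2)))"
      using c by (intro cosh_strange[OF \<open>h > 0\<close>]) simp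
    have "- cosh (h * Re (c - 1 / 2)) \<le> cosh (h * (y + 1 / 2))" for y
      using cosh_real_pos[of "h * Re (c - 1 / 2)"] cosh_real_pos[of "h * (y + 1 / 2)"] by linarith
    then show "- cosh (h * Re (c - 1 / 2)) \<le> cosh (h * (y + 1 / 2)) \<or>
        (\<exists>r\<in>{2..p}. ltop p m r = - y \<or> ltop p m r = y + 1)" for y
      by blast
  qed
next
  fix ii m and t :: real
  assume "0 \<le> t \<and> t < 2 * pi / h"
  show "T_unitary h (2 * p + 2) ii m (\<i> * complex_of_real t)"
  proof (rule T_unitary_even[OF cosh_imaginary])
    show "cos (h * t) \<le> cosh (h * y) \<or>
        (\<exists>r\<in>{2..p + 1}. ltop p m r = - y \<or> ltop p m r = y)" for y
      using order_trans[OF cos_le_one cosh_real_ge_1] by blast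
  qed (simp add: cnj_qnum_imaginary)
next
  fix ii m s and x :: real
  assume "admissible (2 * p + 2) ii m"
    "s \<le> p \<and> (\<forall>r\<in>{1..s}. ltop p m (p - r + 2) = real r - 1)" "0 < x \<and> x < real s"
  then show "T_unitary h (2 * p + 2) ii m (complex_of_real x)"
    using T_unitary_suppl_even[OF assms] by blast
next
  fix ii m c
  assume c: "Im c = pi / h \<and> Re c > 0"
  show "T_unitary h (2 * p + 2) ii m c"
  proof (rule T_unitary_even[OF cosh_strange[OF \<open>h > 0\<close>]])
    show "Im c = pi / h" using c by simp
    have "- cosh (h * Re c) \<le> cosh (h * y)" for y
      using cosh_real_pos[of "h * Re c"] cosh_real_pos[of "h * y"] by linarith
    then show "- cosh (h * Re c) \<le> cosh (h * y) \<or>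
        (\<exists>r\<in>{2..p + 1}. ltop p m r = - y \<or> ltop p m r = y)" for y
      by blast
    show "cnj (qnum h c) = - qnum h c \<or> (\<exists>r\<in>{2..p + 1}. ltop p m r = 0)"
      using cnj_qnum_strange[OF \<open>h > 0\<close>] c by blast
  qed
qed

end
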